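(* Let $(n_1,n_2,n_3)\neq(3,4,5)$ be a Pythagorean triple of positive integers with $n_1<n_2<n_3$. Then the graphical embodiment of $(n_1,n_2,n_3)$ contains exactly one Pythagorean hole.
   Context: All graphs are finite, simple, connected and undirected. A Pythagorean triple is an ordered triple $(a,b,c)$ of positive integers with $a<b<c$ and $a^2+b^2=c^2$. A primitive hole of a graph $G$ is a cycle of length $3$ in $G$. A Pythagorean hole of $G$ is a primitive hole whose three vertices can be labelled $v_i,v_j,v_k$ so that $d_G(v_i)^2+d_G(v_j)^2=d_G(v_k)^2$. The graphical embodiment of a Pythagorean triple $(n_1,n_2,n_3)$ is the following graph $G$ (which the paper identifies as the graph of minimum order and size containing a triangle with vertex degrees $n_1,n_2,n_3$): take a triangle on vertices $v_1,v_2,v_3$; add $n_1-2$ new vertices, each adjacent to exactly $v_1,v_2,v_3$; add $n_2-n_1$ new vertices, each adjacent to exactly $v_2,v_3$; add $n_3-n_2$ new vertices, each adjacent only to $v_3$. Thus $d_G(v_i)=n_i$ for $i=1,2,3$. *)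

theory Defs
  imports "Graph_Theory.Graph_Theory"
begin

text \<open>
  Undirected graphs are represented as in \<^theory>\<open>Graph_Theory.Pair_Digraph\<close>: a finite simple
  undirected graph is a \<^locale>\<open>pair_graph\<close>, every edge being stored as the two opposite arcs.
  The degree of a vertex is therefore its \<^const>\<open>out_degree\<close>.
\<close>

definition pythagorean_triple :: "nat \<Rightarrow> nat \<Rightarrow> nat \<Rightarrow> bool" where
  "pythagorean_triple a b c \<longleftrightarrow> 0 < a \<and> a < b \<and> b < c \<and> a\<^sup>2 + b\<^sup>2 = c\<^sup>2"

text \<open>
  A cycle of an undirected graph is a subgraph: traversals \<^term>\<open>p\<close> of the same cycle that differ in
  starting point or direction give the same \<^term>\<open>H\<close>.
\<close>

definition primitive_hole :: "'a pair_pre_digraph \<Rightarrow> 'a pair_pre_digraph \<Rightarrow> bool" where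
  "primitive_hole G H \<longleftrightarrow>
     (\<exists>p. pre_digraph.cycle (with_proj G) p \<and> length p = 3 \<and>
          H = \<lparr> pverts = fst ` set p, parcs = symcl (set p) \<rparr>)"

definition pythagorean_hole :: "'a pair_pre_digraph \<Rightarrow> 'a pair_pre_digraph \<Rightarrow> bool" where
  "pythagorean_hole G H \<longleftrightarrow> primitive_hole G H \<and>
     (\<exists>u v w. pverts H = {u, v, w} \<and>
        (out_degree (with_proj G) u)\<^sup>2 + (out_degree (with_proj G) v)\<^sup>2
          = (out_degree (with_proj G) w)\<^sup>2)"

text \<open>
  The graphical embodiment is determined up to the choice of its vertices, so it is a predicate on
  \<^term>\<open>G\<close>. The truncated subtractions are harmless: \<^prop>\<open>pythagorean_triple n1 n2 n3\<close>
  implies \<open>3 \<le> n1 < n2 < n3\<close>.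
\<close>

definition graphical_embodiment :: "nat \<Rightarrow> nat \<Rightarrow> nat \<Rightarrow> 'a pair_pre_digraph \<Rightarrow> bool" where
  "graphical_embodiment n1 n2 n3 G \<longleftrightarrow>
     (\<exists>v1 v2 v3 A B C.
        distinct [v1, v2, v3] \<and>
        finite A \<and> finite B \<and> finite C \<and>
        card A = n1 - 2 \<and> card B = n2 - n1 \<and> card C = n3 - n2 \<and>
        A \<inter> {v1, v2, v3} = {} \<and> B \<inter> {v1, v2, v3} = {} \<and> C \<inter> {v1, v2, v3} = {} \<and>
        A \<inter> B = {} \<and> A \<inter> C = {} \<and> B \<inter> C = {} \<and>
        G = \<lparr> pverts = {v1, v2, v3} \<union> A \<union> B \<union> C,
              parcs = symcl ({(v1, v2), (v1, v3), (v2, v3)}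
                        \<union> A \<times> {v1, v2, v3} \<union> B \<times> {v2, v3} \<union> C \<times> {v3}) \<rparr>)"

lemma pythagorean_triple_ge_3:
  assumes "pythagorean_triple a b c"
  shows "3 \<le> a"
proof (rule ccontr)
  assume "\<not> 3 \<le> a"
  then have a: "a = 1 \<or> a = 2" using assms by (auto simp: pythagorean_triple_def)
  obtain d where d: "c = b + d" "0 < d"
    using assms by (metis pythagorean_triple_def less_imp_add_positive)
  have "a\<^sup>2 = 2 * b * d + d\<^sup>2"
    using assms d by (auto simp: pythagorean_triple_def power2_eq_square algebra_simps)
  moreover have "2 * b \<le> 2 * b * d" "1 \<le> d\<^sup>2" using d by auto
  ultimately have "2 * b + 1 \<le> a\<^sup>2" by linarith
  then show False using a assms by (auto simp: pythagorean_triple_def)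
qed

text \<open>The predicate is satisfiable, and yields a connected simple graph with the stated degrees.\<close>

lemma graphical_embodiment_exists:
  assumes "2 \<le> n1" "n1 \<le> n2" "n2 \<le> n3"
  shows "\<exists>G :: nat pair_pre_digraph. graphical_embodiment n1 n2 n3 G"
proof -
  define A B C where "A = {3..<n1 + 1}" and "B = {n1 + 1..<n2 + 1}" and "C = {n2 + 1..<n3 + 1}"
  note ABC = this
  have "distinct [0::nat, 1, 2]" "finite A" "finite B" "finite C"
    by (simp_all add: ABC)
  moreover have "card A = n1 - 2" "card B = n2 - n1" "card C = n3 - n2"
    using assms by (simp_all add: ABC)
  moreover have "A \<inter> {0, 1, 2} = {}" "B \<inter> {0, 1, 2} = {}" "C \<inter> {0, 1, 2} = {}"
    "A \<inter> B = {}" "A \<inter> C = {}" "B \<inter> C = {}"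
    using assms by (simp_all add: ABC disjoint_iff)
  ultimately show ?thesis
    unfolding graphical_embodiment_def by blast
qed

lemma symcl_conv: "symcl R = R \<union> R\<inverse>"
  by (auto simp: symcl_def)

lemma graphical_embodiment_pair_graph:
  assumes "graphical_embodiment n1 n2 n3 G"
  shows "pair_graph G"
proof -
  obtain v1 v2 v3 A B C where v: "distinct [v1, v2, v3]"
    and fin: "finite A" "finite B" "finite C"
    and disj: "A \<inter> {v1, v2, v3} = {}" "B \<inter> {v1, v2, v3} = {}" "C \<inter> {v1, v2, v3} = {}"
    and G: "G = \<lparr> pverts = {v1, v2, v3} \<union> A \<union> B \<union> C,
              parcs = symcl ({(v1, v2), (v1, v3), (v2, v3)}
                        \<union> A \<times> {v1, v2, v3} \<union> B \<times> {v2, v3} \<union> C \<times> {v3}) \<rparr>"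
    using assms unfolding graphical_embodiment_def by blast
  define R where "R = {(v1, v2), (v1, v3), (v2, v3)}
                        \<union> A \<times> {v1, v2, v3} \<union> B \<times> {v2, v3} \<union> C \<times> {v3}"
  have R: "R \<subseteq> pverts G \<times> pverts G" "R \<inter> Id = {}"
    using v disj by (auto simp: R_def G)
  have E: "parcs G = R \<union> R\<inverse>"
    by (simp add: G R_def symcl_conv)
  have finV: "finite (pverts G)"
    using fin by (simp add: G)
  have EV: "parcs G \<subseteq> pverts G \<times> pverts G"
    using R(1) by (auto simp: E)
  show ?thesis
  proof
    show "finite (parcs G)"
      using EV finV by (meson finite_SigmaI finite_subset)
    show "symmetric (with_proj G)"
      by (simp add: symmetric_def E sym_Un_converse)
  qed (use R(2) EV finV in \<open>auto simp: E\<close>)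
qed

lemma graphical_embodiment_connected:
  assumes "graphical_embodiment n1 n2 n3 G"
  shows "connected (with_proj G)"
proof -
  interpret pair_graph G using assms by (rule graphical_embodiment_pair_graph)
  obtain v1 v2 v3 A B C where
    G: "G = \<lparr> pverts = {v1, v2, v3} \<union> A \<union> B \<union> C,
              parcs = symcl ({(v1, v2), (v1, v3), (v2, v3)}
                        \<union> A \<times> {v1, v2, v3} \<union> B \<times> {v2, v3} \<union> C \<times> {v3}) \<rparr>"
    using assms unfolding graphical_embodiment_def by blast
  have v3: "v3 \<in> pverts G" by (simp add: G)
  have adj: "u = v3 \<or> (u, v3) \<in> parcs G \<and> (v3, u) \<in> parcs G" if "u \<in> pverts G" for u
    using that by (simp add: G symcl_conv) blast
  have "strongly_connected (with_proj G)"
  proof (rule strongly_connectedI)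
    fix u v assume uv: "u \<in> verts (with_proj G)" "v \<in> verts (with_proj G)"
    have "u \<rightarrow>\<^sup>*\<^bsub>with_proj G\<^esub> v3" "v3 \<rightarrow>\<^sup>*\<^bsub>with_proj G\<^esub> v"
      using v3 adj[of u] adj[of v] uv by auto
    then show "u \<rightarrow>\<^sup>*\<^bsub>with_proj G\<^esub> v" by (rule reachable_trans)
  qed (use v3 in auto)
  moreover have "symcl (parcs G) = parcs G"
    using pair_sym_arcs by (auto simp: symcl_conv symmetric_def dest: symD)
  ultimately show ?thesis
    by (simp add: connected_conv strongly_connected_def reachable_def)
qed

lemma graphical_embodiment_degrees:
  assumes "graphical_embodiment n1 n2 n3 G" and "2 \<le> n1" "n1 \<le> n2" "n2 \<le> n3"
  shows "\<exists>v1 v2 v3. distinct [v1, v2, v3] \<and>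
    {(v1, v2), (v1, v3), (v2, v3)} \<subseteq> parcs G \<and>
    out_degree (with_proj G) v1 = n1 \<and> out_degree (with_proj G) v2 = n2 \<and>
    out_degree (with_proj G) v3 = n3"
proof -
  obtain v1 v2 v3 A B C where v: "distinct [v1, v2, v3]"
    and fin: "finite A" "finite B" "finite C"
    and card: "card A = n1 - 2" "card B = n2 - n1" "card C = n3 - n2"
    and disj: "A \<inter> {v1, v2, v3} = {}" "B \<inter> {v1, v2, v3} = {}" "C \<inter> {v1, v2, v3} = {}"
       "A \<inter> B = {}" "A \<inter> C = {}" "B \<inter> C = {}"
    and G: "G = \<lparr> pverts = {v1, v2, v3} \<union> A \<union> B \<union> C,
              parcs = symcl ({(v1, v2), (v1, v3), (v2, v3)}
                        \<union> A \<times> {v1, v2, v3} \<union> B \<times> {v2, v3} \<union> C \<times> {v3}) \<rparr>"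
    using assms(1) unfolding graphical_embodiment_def by blast
  have out: "out_degree (with_proj G) x = card N"
    if "out_arcs (with_proj G) x = Pair x ` N" for x N
    using that by (simp add: out_degree_def card_image inj_on_def)
  have "out_arcs (with_proj G) v1 = Pair v1 ` ({v2, v3} \<union> A)"
    using v disj by (auto simp: G out_arcs_def symcl_conv)
  then have 1: "out_degree (with_proj G) v1 = card ({v2, v3} \<union> A)" by (rule out)
  have "out_arcs (with_proj G) v2 = Pair v2 ` ({v1, v3} \<union> (A \<union> B))"
    using v disj by (auto simp: G out_arcs_def symcl_conv)
  then have 2: "out_degree (with_proj G) v2 = card ({v1, v3} \<union> (A \<union> B))" by (rule out)
  have "out_arcs (with_proj G) v3 = Pair v3 ` ({v1, v2} \<union> (A \<union> B \<union> C))"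
    using v disj by (auto simp: G out_arcs_def symcl_conv)
  then have 3: "out_degree (with_proj G) v3 = card ({v1, v2} \<union> (A \<union> B \<union> C))" by (rule out)
  have "card ({v2, v3} \<union> A) = n1" "card ({v1, v3} \<union> (A \<union> B)) = n2"
    "card ({v1, v2} \<union> (A \<union> B \<union> C)) = n3"
    using v disj fin card assms(2-)
    by (subst card_Un_disjoint; auto simp: card_Un_disjoint Int_Un_distrib2)+
  then show ?thesis using v 1 2 3 by (intro exI[of _ v1] exI[of _ v2] exI[of _ v3])
    (auto simp: G symcl_conv)
qed

end

theory Submission
  imports Defs
begin

text \<open>
  A vertex of the graphical embodiment outside the central triangle has degree at most 3, and no two
  such vertices are adjacent. A positive solution of \<open>x\<^sup>2 + y\<^sup>2 = z\<^sup>2\<close> has no entry below 3, and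
  contains 3 only if it is \<open>{3, 4, 5}\<close>. So a further Pythagorean hole would consist of a vertex of
  degree 3 and two central vertices of degrees 4 and 5; this forces \<open>(n\<^sub>1, n\<^sub>2, n\<^sub>3) = (3, 4, 5)\<close>.
\<close>

text \<open>Since \<open>z\<close> exceeds \<open>y\<close>, the gap \<open>z^2 - y^2\<close> is at
  least \<open>(y + 1)^2 - y^2\<close>. A fixed leg \<open>x\<close> thus leaves only finitely many
  candidates for the other leg.\<close>

lemma pythagorean_leg_bound:
  fixes x y z :: nat
  assumes "x\<^sup>2 + y\<^sup>2 = z\<^sup>2" "0 < x"
  shows "2 * y + 1 \<le> x\<^sup>2"
proof -
  have "y\<^sup>2 < z\<^sup>2" using assms by (metis add.commute less_add_same_cancel1 zero_less_power)
  then have "y + 1 \<le> z" using power2_less_imp_less by fastforce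
  then have "(y + 1)\<^sup>2 \<le> z\<^sup>2" by (rule power_mono) simp
  then show ?thesis using assms(1) by (simp add: power2_eq_square algebra_simps)
qed

lemma nat_not_square_between:
  fixes k z n :: nat
  assumes "k\<^sup>2 < n" "n < (k + 1)\<^sup>2"
  shows "z\<^sup>2 \<noteq> n"
proof
  assume "z\<^sup>2 = n"
  then have "k < z" "z < k + 1" using assms power2_less_imp_less by blast+
  then show False by simp
qed

text \<open>The legs are left unordered, so the bound serves for either one. For
  \<open>x = 1\<close> the leg bound forces \<open>y = 0\<close>; for \<open>x = 2\<close> it forces
  \<open>y = 1\<close>.\<close>

lemma pythagorean_leg_ge_3:
  fixes x y z :: nat
  assumes "x\<^sup>2 + y\<^sup>2 = z\<^sup>2" "0 < x" "0 < y"
  shows "3 \<le> x"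
proof (rule ccontr)
  assume "\<not> 3 \<le> x"
  then have x: "x = 1 \<or> x = 2" using assms(2) by auto
  then have "x = 2 \<and> y = 1" using pythagorean_leg_bound[OF assms(1,2)] assms(3) by auto
  then show False
    \<comment> \<open>Here \<open>z^2\<close> would be 5, which lies strictly between 4 and
      9.\<close>
    using assms(1) nat_not_square_between[of 2 5 z] by simp
qed

lemma pythagorean_leg_eq_3:
  fixes y z :: nat
  assumes "3\<^sup>2 + y\<^sup>2 = z\<^sup>2" "0 < y"
  shows "y = 4 \<and> z = 5"
proof -
  have "y \<le> 4" using pythagorean_leg_bound[OF assms(1)] by simp
  then consider "y = 1" | "y = 2" | "y = 3" | "y = 4" using assms(2) by linarith
  then show ?thesis
  proof cases
    case 4
    then have "z\<^sup>2 = 5\<^sup>2" using assms(1) by simp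
    then show ?thesis using 4 by (simp only: power2_eq_iff_nonneg)
  \<comment> \<open>The values 1, 2, 3 of \<open>y\<close> give the sums 10, 13 and 18: the first
    two lie between 9 and 16, the last between 16 and 25.\<close>
  qed (use assms(1) nat_not_square_between[of 3 _ z] nat_not_square_between[of 4 _ z] in auto)
qed

text \<open>A 3-cycle passes through every pair of its vertices, so it is the complete graph on its
  vertex set. Uniqueness of a hole thereby becomes uniqueness of a vertex set.\<close>

lemma (in pair_graph) primitive_hole_iff:
  "primitive_hole G H \<longleftrightarrow>
    (\<exists>S. card S = 3 \<and> S \<times> S - Id \<subseteq> parcs G \<and> H = \<lparr> pverts = S, parcs = S \<times> S - Id \<rparr>)"
proof
  assume "primitive_hole G H"
  then obtain p where p: "cycle p" "length p = 3"
    and H: "H = \<lparr> pverts = fst ` set p, parcs = symcl (set p) \<rparr>"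
    by (auto simp: primitive_hole_def)
  obtain e1 e2 e3 where "p = [e1, e2, e3]"
    using p(2) by (auto simp: length_Suc_conv numeral_3_eq_3)
  with p(1) obtain x y z where p': "p = [(x, y), (y, z), (z, x)]" and "distinct [x, y, z]"
    and arcs: "(x, y) \<in> parcs G" "(y, z) \<in> parcs G" "(z, x) \<in> parcs G"
    by (cases e1; cases e2; cases e3) (auto simp: cycle_def awalk_def)
  moreover have "(y, x) \<in> parcs G" "(z, y) \<in> parcs G" "(x, z) \<in> parcs G"
    using arcs by (auto intro: arcs_symmetric)
  ultimately show "\<exists>S. card S = 3 \<and> S \<times> S - Id \<subseteq> parcs G \<and>
      H = \<lparr> pverts = S, parcs = S \<times> S - Id \<rparr>"
    by (intro exI[of _ "{x, y, z}"]) (auto simp: H symcl_conv)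
next
  assume "\<exists>S. card S = 3 \<and> S \<times> S - Id \<subseteq> parcs G \<and> H = \<lparr> pverts = S, parcs = S \<times> S - Id \<rparr>"
  then obtain x y z where d: "distinct [x, y, z]"
    and arcs: "{x, y, z} \<times> {x, y, z} - Id \<subseteq> parcs G"
    and H: "H = \<lparr> pverts = {x, y, z}, parcs = {x, y, z} \<times> {x, y, z} - Id \<rparr>"
    by (auto simp: card_3_iff)
  let ?p = "[(x, y), (y, z), (z, x)]"
  have "(x, y) \<in> parcs G" "(y, z) \<in> parcs G" "(z, x) \<in> parcs G"
    using arcs d by auto
  then have "cycle ?p"
    using d by (auto simp: cycle_def awalk_def dest: in_arcsD1)
  then show "primitive_hole G H"
    unfolding primitive_hole_def H using d
    by (intro exI[of _ ?p]) (auto simp: symcl_conv)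
qed

text \<open>Besides the central degrees, uniqueness needs control of the outer vertices relative to
  the same \<open>v1\<close>, \<open>v2\<close>, \<open>v3\<close>. The neighbourhoods can be read
  off from \<open>A\<close>, \<open>B\<close> and \<open>C\<close>, which are then
  forgotten.\<close>

lemma graphical_embodimentE:
  assumes "graphical_embodiment n1 n2 n3 G" and "2 \<le> n1" "n1 \<le> n2" "n2 \<le> n3"
  obtains v1 v2 v3 where "distinct [v1, v2, v3]"
    and "{v1, v2, v3} \<times> {v1, v2, v3} - Id \<subseteq> parcs G"
    and "out_degree (with_proj G) v1 = n1" "out_degree (with_proj G) v2 = n2"
      "out_degree (with_proj G) v3 = n3"
    and "\<And>x. x \<in> pverts G - {v1, v2, v3} \<Longrightarrow> out_degree (with_proj G) x \<in> {1, 2, 3}"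
    and "\<And>x y. (x, y) \<in> parcs G \<Longrightarrow> x \<in> {v1, v2, v3} \<or> y \<in> {v1, v2, v3}"
proof -
  obtain v1 v2 v3 A B C where v: "distinct [v1, v2, v3]"
    and fin: "finite A" "finite B" "finite C"
    and card: "card A = n1 - 2" "card B = n2 - n1" "card C = n3 - n2"
    and disj: "A \<inter> {v1, v2, v3} = {}" "B \<inter> {v1, v2, v3} = {}" "C \<inter> {v1, v2, v3} = {}"
       "A \<inter> B = {}" "A \<inter> C = {}" "B \<inter> C = {}"
    and G: "G = \<lparr> pverts = {v1, v2, v3} \<union> A \<union> B \<union> C,
              parcs = symcl ({(v1, v2), (v1, v3), (v2, v3)}
                        \<union> A \<times> {v1, v2, v3} \<union> B \<times> {v2, v3} \<union> C \<times> {v3}) \<rparr>"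
    using assms(1) unfolding graphical_embodiment_def by blast
  have out: "out_degree (with_proj G) x = card {y. (x, y) \<in> parcs G}" for x
  proof -
    have "out_arcs (with_proj G) x = Pair x ` {y. (x, y) \<in> parcs G}"
      by (auto simp: out_arcs_def)
    then show ?thesis by (simp add: out_degree_def card_image inj_on_def)
  qed
  have "{y. (v1, y) \<in> parcs G} = {v2, v3} \<union> A"
    "{y. (v2, y) \<in> parcs G} = {v1, v3} \<union> (A \<union> B)"
    "{y. (v3, y) \<in> parcs G} = {v1, v2} \<union> (A \<union> B \<union> C)"
    using v disj by (auto simp: G symcl_conv)
  \<comment> \<open>The sizes telescope: 2 plus \<open>n1 - 2\<close>, then plus
    \<open>n2 - n1\<close>, then plus \<open>n3 - n2\<close>. The ordering assumptions keep the
    subtractions from truncating.\<close>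
  moreover have "card ({v2, v3} \<union> A) = n1" "card ({v1, v3} \<union> (A \<union> B)) = n2"
    "card ({v1, v2} \<union> (A \<union> B \<union> C)) = n3"
    using v disj fin card assms(2-)
    by (subst card_Un_disjoint; auto simp: card_Un_disjoint Int_Un_distrib2)+
  ultimately have deg: "out_degree (with_proj G) v1 = n1" "out_degree (with_proj G) v2 = n2"
    "out_degree (with_proj G) v3 = n3"
    by (simp_all add: out)
  have deg': "out_degree (with_proj G) x \<in> {1, 2, 3}" if x: "x \<in> pverts G - {v1, v2, v3}" for x
  proof -
    consider "x \<in> A" | "x \<in> B" | "x \<in> C" using x by (auto simp: G)
    then have "{y. (x, y) \<in> parcs G} \<in> {{v1, v2, v3}, {v2, v3}, {v3}}"
    proof cases
      case 1
      then have "{y. (x, y) \<in> parcs G} = {v1, v2, v3}" using disj by (auto simp: G symcl_conv)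
      then show ?thesis by simp
    next
      case 2
      then have "{y. (x, y) \<in> parcs G} = {v2, v3}" using disj by (auto simp: G symcl_conv)
      then show ?thesis by simp
    next
      case 3
      then have "{y. (x, y) \<in> parcs G} = {v3}" using disj by (auto simp: G symcl_conv)
      then show ?thesis by simp
    qed
    then show ?thesis using v unfolding out by (elim insertE emptyE) simp_all
  qed
  show thesis
    by (rule that[OF v _ deg deg']) (auto simp: G symcl_conv)
qed

theorem theorem2p4:
  fixes n1 n2 n3 :: nat and G :: "'a pair_pre_digraph"
  assumes "pythagorean_triple n1 n2 n3"
    and "(n1, n2, n3) \<noteq> (3, 4, 5)"
    and "graphical_embodiment n1 n2 n3 G"
  shows "\<exists>!H. pythagorean_hole G H"
proof -
  interpret pair_graph G using assms(3) by (rule graphical_embodiment_pair_graph)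
  let ?d = "out_degree (with_proj G)"
  have n: "3 \<le> n1" "n1 < n2" "n2 < n3" "n1\<^sup>2 + n2\<^sup>2 = n3\<^sup>2"
    using assms(1) pythagorean_triple_ge_3 by (auto simp: pythagorean_triple_def)
  have "2 \<le> n1" "n1 \<le> n2" "n2 \<le> n3" using n by auto
  from graphical_embodimentE[OF assms(3) this] obtain v1 v2 v3
    where v: "distinct [v1, v2, v3]" "{v1, v2, v3} \<times> {v1, v2, v3} - Id \<subseteq> parcs G"
    and deg: "?d v1 = n1" "?d v2 = n2" "?d v3 = n3"
    and deg_outer: "\<And>x. x \<in> pverts G - {v1, v2, v3} \<Longrightarrow> ?d x \<in> {1, 2, 3}"
    and outer: "\<And>x y. (x, y) \<in> parcs G \<Longrightarrow> x \<in> {v1, v2, v3} \<or> y \<in> {v1, v2, v3}"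
    by blast
  define V where "V = {v1, v2, v3}"
  have cardV: "card V = 3" using v(1) by (simp add: V_def)
  have deg_pos: "0 < ?d x" if "x \<in> pverts G" for x
    using that deg deg_outer[of x] n by (cases "x \<in> V") (auto simp: V_def)
  have no_345: "\<not> (x \<in> V \<and> y \<in> V \<and> ?d x = 4 \<and> ?d y = 5)" for x y
  proof
    assume "x \<in> V \<and> y \<in> V \<and> ?d x = 4 \<and> ?d y = 5"
    \<comment> \<open>No integer lies strictly between 4 and 5, so these must be neighbouring
      entries of the increasing triple.\<close>
    then have "n1 = 4 \<and> n2 = 5 \<or> n2 = 4 \<and> n3 = 5"
      using deg n(1-3) by (auto simp: V_def)
    then show False
    proof
      assume "n1 = 4 \<and> n2 = 5"
      \<comment> \<open>\<open>4^2 + 5^2 = 41\<close> lies strictly between 36 and 49.\<close>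
      then show False using n(4) nat_not_square_between[of 6 41 n3] by simp
    next
      assume "n2 = 4 \<and> n3 = 5"
      \<comment> \<open>\<open>3 \<le> n1 < 4\<close> leaves only the excluded triple.\<close>
      then show False using n(1,2) assms(2) by auto
    qed
  qed
  have leg: "u \<in> V" if uvw: "distinct [u, v, w]" "{u, v, w} \<times> {u, v, w} - Id \<subseteq> parcs G"
    and eq: "(?d u)\<^sup>2 + (?d v)\<^sup>2 = (?d w)\<^sup>2" for u v w
  proof (rule ccontr)
    assume "u \<notin> V"
    have arcs: "(u, v) \<in> parcs G" "(u, w) \<in> parcs G" using uvw by auto
    then have "v \<in> V" "w \<in> V" using outer \<open>u \<notin> V\<close> unfolding V_def by blast+
    have pverts: "u \<in> pverts G" "v \<in> pverts G" using arcs by (auto dest: in_arcsD1 in_arcsD2)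
    then have "3 \<le> ?d u" using pythagorean_leg_ge_3[OF eq] deg_pos by simp
    then have "?d u = 3" using deg_outer[of u] pverts \<open>u \<notin> V\<close> by (auto simp: V_def)
    then have "?d v = 4 \<and> ?d w = 5" using pythagorean_leg_eq_3 eq deg_pos[OF pverts(2)] by simp
    then show False using no_345 \<open>v \<in> V\<close> \<open>w \<in> V\<close> by blast
  qed
  \<comment> \<open>The degree of \<open>w\<close> exceeds that of a leg, which is at least 3,
    whereas outer degrees are at most 3.\<close>
  have hyp: "w \<in> V" if uvw: "distinct [u, v, w]" "{u, v, w} \<times> {u, v, w} - Id \<subseteq> parcs G"
    and eq: "(?d u)\<^sup>2 + (?d v)\<^sup>2 = (?d w)\<^sup>2" for u v w
  proof (rule ccontr)
    assume "w \<notin> V"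
    have "(u, v) \<in> parcs G" "(v, w) \<in> parcs G" using uvw by auto
    then have pverts: "u \<in> pverts G" "v \<in> pverts G" "w \<in> pverts G"
      by (auto dest: in_arcsD1 in_arcsD2)
    have "3 \<le> ?d u" using pythagorean_leg_ge_3[OF eq] deg_pos pverts by simp
    then have "0 < (?d u)\<^sup>2" by simp
    then have "(?d v)\<^sup>2 < (?d w)\<^sup>2" using eq by linarith
    then have "?d v < ?d w" by (rule power2_less_imp_less) simp
    moreover have "3 \<le> ?d v"
      using pythagorean_leg_ge_3[of "?d v" "?d u" "?d w"] eq deg_pos pverts by (simp add: add.commute)
    ultimately show False using deg_outer[of w] pverts \<open>w \<notin> V\<close> by (auto simp: V_def)
  qed
  let ?H = "\<lparr> pverts = V, parcs = V \<times> V - Id \<rparr>"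
  show ?thesis
  proof (rule ex1I[of _ ?H])
    have "primitive_hole G ?H"
      using v(2) cardV unfolding primitive_hole_iff V_def by blast
    then show "pythagorean_hole G ?H"
      unfolding pythagorean_hole_def using deg n(4) by (auto simp: V_def)
  next
    fix H
    assume "pythagorean_hole G H"
    then obtain S u v w where S: "card S = 3" "S \<times> S - Id \<subseteq> parcs G"
      and H: "H = \<lparr> pverts = S, parcs = S \<times> S - Id \<rparr>" and "pverts H = {u, v, w}"
      and eq: "(?d u)\<^sup>2 + (?d v)\<^sup>2 = (?d w)\<^sup>2"
      unfolding pythagorean_hole_def primitive_hole_iff by blast
    then have S': "S = {u, v, w}" by simp
    \<comment> \<open>The labelling in \<open>pythagorean_hole\<close> only says that
      \<open>u\<close>, \<open>v\<close>, \<open>w\<close> exhaust the vertex set; having three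
      vertices rules out repetitions.\<close>
    then have uvw: "distinct [u, v, w]"
      using S(1) by (auto simp: card_insert_if split: if_splits)
    have "u \<in> V" "w \<in> V" using leg hyp uvw S(2) eq unfolding S' by blast+
    moreover have "v \<in> V"
    \<comment> \<open>The equation is symmetric in its legs, so \<open>leg\<close> applies with
      \<open>u\<close> and \<open>v\<close> exchanged.\<close>
    proof (rule leg)
      show "distinct [v, u, w]" using uvw by auto
      show "{v, u, w} \<times> {v, u, w} - Id \<subseteq> parcs G" using S(2) unfolding S' by blast
      show "(?d v)\<^sup>2 + (?d u)\<^sup>2 = (?d w)\<^sup>2" using eq by simp
    qed
    ultimately have "S \<subseteq> V" by (simp add: S')
    then have "S = V" using S(1) cardV by (intro card_subset_eq) (auto simp: V_def)
    then show "H = ?H" by (simp add: H)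
  qed
qed

end
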